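(* Let $A\in\mathbb{R}^{n\times n}$ and consider two randomized Arnoldi factorizations obtained after $k$ steps, $$AV = VH + r e_k^T,\qquad AQ = QG + f e_k^T,$$ where $V,Q\in\mathbb{R}^{n\times k}$, $H,G\in\mathbb{R}^{k\times k}$, $r,f\in\mathbb{R}^n$, $\Omega\in\mathbb{R}^{d\times n}$ is an $\epsilon$-embedding for $\mathrm{span}\{V,r,Q,f\}$ (the span of the columns of $V$ and $Q$ together with $r$ and $f$), the matrices $V,Q$ are $\Omega$-orthonormal, and $H,G$ are upper Hessenberg with positive subdiagonal elements. If the starting vectors are equal, i.e. $Ve_1=Qe_1$, and if $r$ is $\Omega$-orthogonal to the columns of $V$ and $f$ is $\Omega$-orthogonal to the columns of $Q$, then $V=Q$, $H=G$ and $r=f$; equivalently, the two decompositions are the same.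
   Context: All inner products and norms are Euclidean; $e_j$ denotes the $j$-th canonical vector of $\mathbb{R}^k$. $\Omega$ is an $\epsilon$-embedding for a subspace $\mathcal{S}\subset\mathbb{R}^n$ (with $\epsilon\in[0,1)$) if $(1-\epsilon)\|x\|^2\le\|\Omega x\|^2\le(1+\epsilon)\|x\|^2$ for all $x\in\mathcal{S}$. Vectors $x,y$ are $\Omega$-orthogonal if $(\Omega x)^T(\Omega y)=0$; a matrix $V$ with $k$ columns is $\Omega$-orthonormal if $(\Omega V)^T(\Omega V)=I_k$. A $k$-step randomized Arnoldi factorization with starting vector $v_1$ is a relation $AV=VH+re_k^T$ in which $V$ is an $\Omega$-orthonormal basis of the $k$-dimensional Krylov subspace $\mathcal{K}_k=\mathrm{span}\{v_1,Av_1,\dots,A^{k-1}v_1\}$ with $Ve_1=v_1$, $H$ is upper Hessenberg with positive subdiagonal elements and $r$ is $\Omega$-orthogonal to $\mathcal{K}_k$. *)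

theory Defs
  imports Complex_Main "Jordan_Normal_Form.Matrix" "Jordan_Normal_Form.VS_Connect"
begin

definition eucl_norm :: "real vec \<Rightarrow> real" where
  "eucl_norm x = sqrt (x \<bullet> x)"

abbreviation real_span :: "nat \<Rightarrow> real vec set \<Rightarrow> real vec set" where
  "real_span n S \<equiv> LinearCombinations.module.span class_ring (module_vec TYPE(real) n) S"

definition eps_embedding :: "real \<Rightarrow> real mat \<Rightarrow> real vec set \<Rightarrow> bool" where
  "eps_embedding \<epsilon> \<Omega> S \<longleftrightarrow> 0 \<le> \<epsilon> \<and> \<epsilon> < 1 \<and>
     (\<forall>x\<in>S. (1 - \<epsilon>) * (eucl_norm x)\<^sup>2 \<le> (eucl_norm (\<Omega> *\<^sub>v x))\<^sup>2 \<and>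
            (eucl_norm (\<Omega> *\<^sub>v x))\<^sup>2 \<le> (1 + \<epsilon>) * (eucl_norm x)\<^sup>2)"

definition sketch_orthogonal :: "real mat \<Rightarrow> real vec \<Rightarrow> real vec \<Rightarrow> bool" where
  "sketch_orthogonal \<Omega> x y \<longleftrightarrow> (\<Omega> *\<^sub>v x) \<bullet> (\<Omega> *\<^sub>v y) = 0"

definition sketch_orthonormal :: "real mat \<Rightarrow> real mat \<Rightarrow> bool" where
  "sketch_orthonormal \<Omega> V \<longleftrightarrow>
     transpose_mat (\<Omega> * V) * (\<Omega> * V) = 1\<^sub>m (dim_col V)"

definition upper_hessenberg :: "real mat \<Rightarrow> bool" where
  "upper_hessenberg H \<longleftrightarrow>
     (\<forall>i < dim_row H. \<forall>j < dim_col H. j + 1 < i \<longrightarrow> H $$ (i, j) = 0)"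

definition pos_subdiagonal :: "real mat \<Rightarrow> bool" where
  "pos_subdiagonal H \<longleftrightarrow>
     (\<forall>j. j + 1 < dim_row H \<and> j < dim_col H \<longrightarrow> 0 < H $$ (j + 1, j))"

text \<open>The rank-one matrix \<open>x y\<^sup>T\<close>, as the product of a column and a row.\<close>

definition outer_prod :: "real vec \<Rightarrow> real vec \<Rightarrow> real mat" where
  "outer_prod x y = mat_of_cols (dim_vec x) [x] * mat_of_rows (dim_vec y) [y]"

end

theory Submission
  imports Defs
begin

text \<open>
  The sketched form \<open>\<langle>x, y\<rangle> = (\<Omega> x) \<bullet> (\<Omega> y)\<close> turns the argument into the classical implicit
  Q theorem.  Multiplying \<open>A V = V H + r e\<^sub>k\<^sup>T\<close> by \<open>(\<Omega> V)\<^sup>T \<Omega>\<close> kills the residual and leaves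
  \<open>H\<close>, so that \<open>H\<^bsub>ij\<^esub> = \<langle>v\<^sub>i, A v\<^sub>j\<rangle>\<close> depends only on the basis (\<open>hessenberg_entry\<close>).

  It remains to see that the basis is determined by its first vector.  If two bases agree up to
  index \<open>j\<close>, then \<open>H\<close> and \<open>G\<close> agree in rows \<open>0, \<dots>, j\<close> of column \<open>j\<close>.  By the Hessenberg shape
  the only further term of column \<open>j\<close> is the one in the next basis vector, whence
  \<open>h v\<^bsub>j+1\<^esub> = g q\<^bsub>j+1\<^esub>\<close> with subdiagonal entries \<open>h, g > 0\<close>.  Both vectors have unit sketched
  length, so the positive factors coincide, and hence the vectors do
  (\<open>sketch_unit_vectors_eqI\<close>, \<open>next_basis_vector_unique\<close>).  Once \<open>V = Q\<close>, the entry formula gives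
  \<open>H = G\<close>, and the last column of the factorization gives \<open>r = f\<close>.
\<close>

lemma index_outer_prod_unit_vec:
  assumes "r \<in> carrier_vec n" "a < n" "j < k"
  shows "outer_prod r (unit_vec k (k - 1)) $$ (a, j) = (if j = k - 1 then r $ a else 0)"
  using assms by (auto simp: outer_prod_def scalar_prod_def mat_of_cols_def mat_of_rows_def)

lemma mult_mat_unit_vec:
  fixes M :: "real mat"
  assumes "M \<in> carrier_mat n k" "i < k"
  shows "M *\<^sub>v unit_vec k i = col M i"
  using assms by (intro eq_vecI) auto

lemma sketch_unit_vectors_eqI:
  fixes \<Omega> :: "real mat"
  assumes \<Omega>: "\<Omega> \<in> carrier_mat d n" and x: "x \<in> carrier_vec n" and y: "y \<in> carrier_vec n"
    and x1: "(\<Omega> *\<^sub>v x) \<bullet> (\<Omega> *\<^sub>v x) = 1" and y1: "(\<Omega> *\<^sub>v y) \<bullet> (\<Omega> *\<^sub>v y) = 1"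
    and c: "0 < c" and c': "0 < c'" and eq: "c \<cdot>\<^sub>v x = c' \<cdot>\<^sub>v y"
  shows "x = y"
proof -
  have sq: "(\<Omega> *\<^sub>v (b \<cdot>\<^sub>v z)) \<bullet> (\<Omega> *\<^sub>v (b \<cdot>\<^sub>v z)) = b\<^sup>2"
    if "z \<in> carrier_vec n" "(\<Omega> *\<^sub>v z) \<bullet> (\<Omega> *\<^sub>v z) = 1" for b z
    using that \<Omega> by (simp add: mult_mat_vec power2_eq_square)
  have "c\<^sup>2 = c'\<^sup>2"
    using sq[OF x x1, of c] sq[OF y y1, of c'] eq by simp
  then have "c = c'"
    using c c' by simp
  show ?thesis
  proof (rule eq_vecI)
    show "dim_vec x = dim_vec y" using x y by simp
    fix a assume "a < dim_vec y"
    then have "a < n" using y by simp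
    moreover have "(c \<cdot>\<^sub>v x) $ a = (c' \<cdot>\<^sub>v y) $ a" using eq by simp
    ultimately show "x $ a = y $ a" using x y c \<open>c = c'\<close> by simp
  qed
qed

locale randomized_arnoldi =
  fixes A V H \<Omega> :: "real mat" and r :: "real vec" and n k d :: nat
  assumes A: "A \<in> carrier_mat n n"
    and V: "V \<in> carrier_mat n k"
    and H: "H \<in> carrier_mat k k"
    and r: "r \<in> carrier_vec n"
    and Omega: "\<Omega> \<in> carrier_mat d n"
    and factorization: "A * V = V * H + outer_prod r (unit_vec k (k - 1))"
    and orthonormal: "sketch_orthonormal \<Omega> V"
    and hess: "upper_hessenberg H" and subdiag: "pos_subdiagonal H"
    and orth: "\<forall>j<k. sketch_orthogonal \<Omega> r (col V j)"
begin

lemma index_factorization: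
  assumes "a < n" "j < k"
  shows "(A *\<^sub>v col V j) $ a =
    (\<Sum>i<k. V $$ (a, i) * H $$ (i, j)) + (if j = k - 1 then r $ a else 0)"
proof -
  have "(A *\<^sub>v col V j) $ a = (A * V) $$ (a, j)"
    using A V assms by simp
  also have "\<dots> = (V * H) $$ (a, j) + outer_prod r (unit_vec k (k - 1)) $$ (a, j)"
    using r assms by (simp add: factorization outer_prod_def)
  also have "(V * H) $$ (a, j) = (\<Sum>i<k. V $$ (a, i) * H $$ (i, j))"
    using V H assms by (simp add: scalar_prod_def atLeast0LessThan)
  finally show ?thesis
    using index_outer_prod_unit_vec[OF r assms] by simp
qed

lemma col_factorization:
  assumes "j < k"
  shows "A *\<^sub>v col V j = V *\<^sub>v col H j + (if j = k - 1 then 1 else 0) \<cdot>\<^sub>v r"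
proof (rule eq_vecI)
  fix a assume "a < dim_vec (V *\<^sub>v col H j + (if j = k - 1 then 1 else 0) \<cdot>\<^sub>v r)"
  then have a: "a < n" using r by simp
  have "(V *\<^sub>v col H j) $ a = (\<Sum>i<k. V $$ (a, i) * H $$ (i, j))"
    using V H a assms by (simp add: scalar_prod_def atLeast0LessThan)
  then show "(A *\<^sub>v col V j) $ a = (V *\<^sub>v col H j + (if j = k - 1 then 1 else 0) \<cdot>\<^sub>v r) $ a"
    unfolding index_factorization[OF a assms] using V r a by simp
qed (use A r in simp)

lemma sketch_coordinate:
  assumes i: "i < k" and h: "h \<in> carrier_vec k"
  shows "(\<Omega> *\<^sub>v col V i) \<bullet> (\<Omega> *\<^sub>v (V *\<^sub>v h)) = h $ i"
proof -
  let ?W = "\<Omega> * V"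
  have W: "?W \<in> carrier_mat d k" using Omega V by simp
  have "(\<Omega> *\<^sub>v col V i) \<bullet> (\<Omega> *\<^sub>v (V *\<^sub>v h)) = col ?W i \<bullet> (?W *\<^sub>v h)"
    unfolding col_mult2[OF Omega V i] assoc_mult_mat_vec[OF Omega V h] ..
  also have "\<dots> = (transpose_mat ?W *\<^sub>v (?W *\<^sub>v h)) $ i"
    using W V i by simp
  also have "transpose_mat ?W *\<^sub>v (?W *\<^sub>v h) = (transpose_mat ?W * ?W) *\<^sub>v h"
    using W h by (metis assoc_mult_mat_vec transpose_carrier_mat)
  also have "transpose_mat ?W * ?W = 1\<^sub>m k"
    using orthonormal V by (simp add: sketch_orthonormal_def)
  finally show ?thesis using h by simp
qed

lemma sketch_unit_col:
  assumes "i < k"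
  shows "(\<Omega> *\<^sub>v col V i) \<bullet> (\<Omega> *\<^sub>v col V i) = 1"
  using sketch_coordinate[OF assms, of "unit_vec k i"] mult_mat_unit_vec[OF V assms] assms
  by simp

text \<open>The entries of the Hessenberg matrix are sketched inner products because the residual is
  orthogonal to every basis vector; this is what makes \<open>H\<close> a function of \<open>A\<close>, \<open>\<Omega>\<close> and \<open>V\<close>.\<close>

lemma hessenberg_entry:
  assumes i: "i < k" and j: "j < k"
  shows "H $$ (i, j) = (\<Omega> *\<^sub>v col V i) \<bullet> (\<Omega> *\<^sub>v (A *\<^sub>v col V j))"
proof -
  define c :: real where "c = (if j = k - 1 then 1 else 0)"
  let ?v = "\<Omega> *\<^sub>v col V i"
  have h: "col H j \<in> carrier_vec k" using H j by simp
  have v: "?v \<in> carrier_vec d" using Omega V i by simp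
  have Vh: "V *\<^sub>v col H j \<in> carrier_vec n" using V h by simp
  have Or: "\<Omega> *\<^sub>v r \<in> carrier_vec d" using Omega r by simp
  have OVh: "\<Omega> *\<^sub>v (V *\<^sub>v col H j) \<in> carrier_vec d" using Omega Vh by simp
  have cr: "c \<cdot>\<^sub>v r \<in> carrier_vec n" using r by simp
  have "\<Omega> *\<^sub>v (A *\<^sub>v col V j) = \<Omega> *\<^sub>v (V *\<^sub>v col H j) + c \<cdot>\<^sub>v (\<Omega> *\<^sub>v r)"
    unfolding col_factorization[OF j] c_def[symmetric]
      mult_add_distrib_mat_vec[OF Omega Vh cr] mult_mat_vec[OF Omega r] ..
  then have "?v \<bullet> (\<Omega> *\<^sub>v (A *\<^sub>v col V j)) = ?v \<bullet> (\<Omega> *\<^sub>v (V *\<^sub>v col H j)) + c * (?v \<bullet> (\<Omega> *\<^sub>v r))"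
    using scalar_prod_add_distrib[OF v OVh smult_carrier_vec[THEN iffD2, OF Or]]
      scalar_prod_smult_distrib[OF v Or] by simp
  moreover have "?v \<bullet> (\<Omega> *\<^sub>v r) = 0"
    using orth i comm_scalar_prod[OF v Or] by (simp add: sketch_orthogonal_def)
  ultimately show ?thesis
    using sketch_coordinate[OF i h] H i j by simp
qed

text \<open>The recurrence that produces the next basis vector: below the diagonal only one entry of
  each column survives.\<close>

lemma arnoldi_recurrence:
  assumes a: "a < n" and j: "Suc j < k"
  shows "(A *\<^sub>v col V j) $ a =
    (\<Sum>i\<le>j. V $$ (a, i) * H $$ (i, j)) + H $$ (Suc j, j) * V $$ (a, Suc j)"
proof -
  have "(\<Sum>i<k. V $$ (a, i) * H $$ (i, j)) = (\<Sum>i\<le>Suc j. V $$ (a, i) * H $$ (i, j))"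
    using hess H j by (intro sum.mono_neutral_right) (auto simp: upper_hessenberg_def)
  then show ?thesis
    using index_factorization[OF a, of j] j by simp
qed

end

text \<open>The coefficients at the known vectors are sketched inner products of known vectors, so the
  two recurrences leave the same vector once these terms are subtracted; the next basis vector is
  its sketched normalization, where positivity of the subdiagonal fixes the sign.\<close>

lemma next_basis_vector_unique:
  assumes arnoldi_V: "randomized_arnoldi A V H \<Omega> r n k d"
    and arnoldi_Q: "randomized_arnoldi A Q G \<Omega> f n k d"
    and j: "Suc j < k" and agree: "\<And>i. i \<le> j \<Longrightarrow> col V i = col Q i"
  shows "col V (Suc j) = col Q (Suc j)"
proof -
  interpret V: randomized_arnoldi A V H \<Omega> r n k d by fact
  interpret Q: randomized_arnoldi A Q G \<Omega> f n k d by fact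
  have VQ: "V $$ (a, i) = Q $$ (a, i)" if "a < n" "i \<le> j" for a i
  proof -
    have "col V i $ a = col Q i $ a" using agree that by simp
    then show ?thesis using V.V Q.V that j by simp
  qed
  have HG: "H $$ (i, j) = G $$ (i, j)" if "i \<le> j" for i
    using V.hessenberg_entry[of i j] Q.hessenberg_entry[of i j] that j agree by simp
  have scaled: "H $$ (Suc j, j) \<cdot>\<^sub>v col V (Suc j) = G $$ (Suc j, j) \<cdot>\<^sub>v col Q (Suc j)"
  proof (rule eq_vecI)
    fix a assume "a < dim_vec (G $$ (Suc j, j) \<cdot>\<^sub>v col Q (Suc j))"
    then have a: "a < n" using Q.V by simp
    have "(A *\<^sub>v col V j) $ a = (A *\<^sub>v col Q j) $ a" using agree by simp
    then have "H $$ (Suc j, j) * V $$ (a, Suc j) = G $$ (Suc j, j) * Q $$ (a, Suc j)"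
      unfolding V.arnoldi_recurrence[OF a j] Q.arnoldi_recurrence[OF a j]
      using VQ[OF a] HG by simp
    then show "(H $$ (Suc j, j) \<cdot>\<^sub>v col V (Suc j)) $ a = (G $$ (Suc j, j) \<cdot>\<^sub>v col Q (Suc j)) $ a"
      using V.V Q.V a j by simp
  qed (use V.V Q.V in simp)
  have "0 < H $$ (Suc j, j)" "0 < G $$ (Suc j, j)"
    using V.subdiag Q.subdiag V.H Q.H j by (auto simp: pos_subdiagonal_def)
  moreover have "col V (Suc j) \<in> carrier_vec n" "col Q (Suc j) \<in> carrier_vec n"
    using V.V Q.V j by simp_all
  ultimately show ?thesis
    using sketch_unit_vectors_eqI[OF V.Omega] V.sketch_unit_col[OF j] Q.sketch_unit_col[OF j] scaled
    by blast
qed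

theorem theorem5p4:
  fixes A V Q H G \<Omega> :: "real mat"
    and r f :: "real vec"
    and n k d :: nat
    and \<epsilon> :: real
  assumes k_pos: "1 \<le> k"
    and A: "A \<in> carrier_mat n n"
    and V: "V \<in> carrier_mat n k" and Q: "Q \<in> carrier_mat n k"
    and H: "H \<in> carrier_mat k k" and G: "G \<in> carrier_mat k k"
    and r: "r \<in> carrier_vec n" and f: "f \<in> carrier_vec n"
    and Omega: "\<Omega> \<in> carrier_mat d n"
    and fact_V: "A * V = V * H + outer_prod r (unit_vec k (k - 1))"
    and fact_Q: "A * Q = Q * G + outer_prod f (unit_vec k (k - 1))"
    and embedding: "eps_embedding \<epsilon> \<Omega>
          (real_span n (set (cols V) \<union> {r} \<union> set (cols Q) \<union> {f}))"
    and orthonormal_V: "sketch_orthonormal \<Omega> V"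
    and orthonormal_Q: "sketch_orthonormal \<Omega> Q"
    and hess_H: "upper_hessenberg H" and subdiag_H: "pos_subdiagonal H"
    and hess_G: "upper_hessenberg G" and subdiag_G: "pos_subdiagonal G"
    and start: "V *\<^sub>v unit_vec k 0 = Q *\<^sub>v unit_vec k 0"
    and orth_r: "\<forall>j<k. sketch_orthogonal \<Omega> r (col V j)"
    and orth_f: "\<forall>j<k. sketch_orthogonal \<Omega> f (col Q j)"
  shows "V = Q \<and> H = G \<and> r = f"
proof -
  interpret V: randomized_arnoldi A V H \<Omega> r n k d
    using A V H r Omega fact_V orthonormal_V hess_H subdiag_H orth_r by unfold_locales
  interpret Q: randomized_arnoldi A Q G \<Omega> f n k d
    using A Q G f Omega fact_Q orthonormal_Q hess_G subdiag_G orth_f by unfold_locales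
  have "col V 0 = col Q 0"
    using start mult_mat_unit_vec[OF V, of 0] mult_mat_unit_vec[OF Q, of 0] k_pos by simp
  then have cols: "j < k \<Longrightarrow> col V j = col Q j" for j
  proof (induction j rule: less_induct)
    case (less j)
    show ?case
    proof (cases j)
      case 0
      then show ?thesis using less.prems by simp
    next
      case (Suc i)
      then show ?thesis
        using next_basis_vector_unique[OF V.randomized_arnoldi_axioms Q.randomized_arnoldi_axioms]
          less by simp
    qed
  qed
  have "V = Q"
    using V Q cols by (intro mat_col_eqI) auto
  moreover have "H = G"
    using H G V.hessenberg_entry Q.hessenberg_entry \<open>V = Q\<close> by (intro eq_matI) auto
  moreover have "r = f"
  proof (rule eq_vecI)
    fix a assume "a < dim_vec f"
    then have a: "a < n" using f by simp
    \<comment> \<open>The residual is visible only in the last column.\<close>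
    show "r $ a = f $ a"
      using V.index_factorization[OF a, of "k - 1"] Q.index_factorization[OF a, of "k - 1"]
        \<open>V = Q\<close> \<open>H = G\<close> k_pos by simp
  qed (use r f in simp)
  ultimately show ?thesis by blast
qed

end
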